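(* Let $R=K[x_1,\ldots,x_n]$ be a polynomial ring over a field $K$. Let $I$ be a monomial ideal of $R$, with $G(I)=\{x^{v_1},\ldots,x^{v_r}\}$ and $v_i=(v_{i1},\ldots,v_{in})$ for $i=1,\ldots,r$, and let $I=I_1\cap\cdots\cap I_m$ be its irreducible decomposition. Then $$\{x_j^{v_{ij}}\mid 1\le i\le r,\ 1\le j\le n,\ v_{ij}\geq 1\}=G(I_1)\cup\cdots\cup G(I_m).$$
   Context: For a monomial ideal $J\subset R$, $G(J)$ denotes its unique minimal set of generators consisting of monomials; $x^a=x_1^{a_1}\cdots x_n^{a_n}$ for $a=(a_1,\ldots,a_n)$. An ideal is irreducible if it is not an intersection of two ideals properly containing it; the irreducible monomial ideals of $R$ are, up to permutation of the variables, the ideals $(x_1^{a_1},\ldots,x_s^{a_s})$ with all $a_i\geq 1$. Every monomial ideal $I$ has a unique irreducible decomposition $I=I_1\cap\cdots\cap I_m$ where $I_1,\ldots,I_m$ are irreducible monomial ideals and $I\neq\bigcap_{i\neq j}I_i$ for $j=1,\ldots,m$. *)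

theory Defs
  imports Complex_Main "HOL-Library.Poly_Mapping"
begin

text \<open>
  The polynomial ring in the variables indexed by the finite type \<open>'n\<close>, with \<open>n = CARD('n)\<close>.
  An exponent vector is a map \<open>a :: 'n \<Rightarrow>\<^sub>0 nat\<close>; its entries are \<open>lookup a j\<close>.
  Multiplication of \<open>poly_mapping\<close> is convolution, i.e. multiplication of polynomials.
\<close>

type_synonym ('n, 'k) mvpoly = "('n \<Rightarrow>\<^sub>0 nat) \<Rightarrow>\<^sub>0 'k"

definition monom :: "('n \<Rightarrow>\<^sub>0 nat) \<Rightarrow> ('n, 'k::comm_ring_1) mvpoly"
  where "monom a = Poly_Mapping.single a 1"

definition var :: "'n \<Rightarrow> ('n, 'k::comm_ring_1) mvpoly"
  where "var j = monom (Poly_Mapping.single j 1)"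

text \<open>Ideals of a commutative ring are the submodules of the ring acting on itself.\<close>

lemma module_times: "module ((*) :: 'a::comm_ring_1 \<Rightarrow> 'a \<Rightarrow> 'a)"
  by unfold_locales (simp_all add: algebra_simps)

definition is_ideal :: "'a::comm_ring_1 set \<Rightarrow> bool"
  where "is_ideal I \<longleftrightarrow> module.subspace (*) I"

definition ideal_generated :: "'a::comm_ring_1 set \<Rightarrow> 'a set"
  where "ideal_generated S = module.span (*) S"

definition monomial_ideal :: "('n, 'k::comm_ring_1) mvpoly set \<Rightarrow> bool"
  where "monomial_ideal I \<longleftrightarrow> (\<exists>S \<subseteq> range monom. I = ideal_generated S)"

text \<open>
  \<open>min_gens I\<close> is the set written \<open>G(I)\<close>. The description determines it when \<open>I\<close> is a
  monomial ideal; otherwise no set of monomials generates \<open>I\<close> and the value is unspecified.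
\<close>

definition is_min_monomial_gens ::
    "('n, 'k::comm_ring_1) mvpoly set \<Rightarrow> ('n, 'k) mvpoly set \<Rightarrow> bool"
  where "is_min_monomial_gens I G \<longleftrightarrow>
    G \<subseteq> range monom \<and> ideal_generated G = I \<and> (\<forall>H. H \<subset> G \<longrightarrow> ideal_generated H \<noteq> I)"

definition min_gens :: "('n, 'k::comm_ring_1) mvpoly set \<Rightarrow> ('n, 'k) mvpoly set"
  where "min_gens I = (THE G. is_min_monomial_gens I G)"

text \<open>
  Irreducible ideals are taken to be proper, so that the irreducible monomial ideals are exactly
  those generated by positive powers of distinct variables; the unit ideal would satisfy the last
  clause vacuously. The zero ideal (no generators) is irreducible.
\<close>

definition irreducible_ideal :: "'a::comm_ring_1 set \<Rightarrow> bool"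
  where "irreducible_ideal I \<longleftrightarrow> is_ideal I \<and> I \<noteq> UNIV \<and>
    \<not> (\<exists>J L. is_ideal J \<and> is_ideal L \<and> I \<subset> J \<and> I \<subset> L \<and> I = J \<inter> L)"

text \<open>
  The components are \<open>Q 1, \<dots>, Q m\<close>. An empty intersection is the whole ring \<open>UNIV\<close>, so the unit
  ideal has the decomposition with \<open>m = 0\<close>.
\<close>

definition irreducible_decomposition ::
    "('n, 'k::comm_ring_1) mvpoly set \<Rightarrow> nat \<Rightarrow> (nat \<Rightarrow> ('n, 'k) mvpoly set) \<Rightarrow> bool"
  where "irreducible_decomposition I m Q \<longleftrightarrow>
    (\<forall>i\<in>{1..m}. irreducible_ideal (Q i) \<and> monomial_ideal (Q i)) \<and>
    I = (\<Inter>i\<in>{1..m}. Q i) \<and>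
    (\<forall>j\<in>{1..m}. I \<noteq> (\<Inter>i\<in>{1..m} - {j}. Q i))"

end

theory Submission
  imports Defs
begin

text \<open>
  A monomial ideal is determined by the set of exponent vectors of the monomials in it: a polynomial
  belongs to the ideal iff all its exponent vectors do (\<open>mem_monomial_ideal_iff\<close>). This set is closed
  upwards in the componentwise order, intersections of ideals become intersections of upward closed
  sets, and \<open>G(I)\<close> becomes the set of minimal elements (\<open>min_gens_monomial_ideal\<close>).

  For a component \<open>Q\<close>, irreducibility enters through a single fact: a minimal generator of \<open>Q\<close> is
  not a product of two coprime monomials \<open>\<noteq> 1\<close>, so it is a pure power of a variable
  (\<open>minimal_exponent_irreducible\<close>). Hence an exponent vector \<open>a\<close> belongs to \<open>Q\<close> iff a single one
  of its coordinates is large enough to put \<open>x\<^sub>j\<close> to the power \<open>a\<^sub>j\<close> into \<open>Q\<close>; the monomials outside \<open>Q\<close>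
  form a box, and the pure powers in \<open>G(Q)\<close> are its faces.

  The theorem compares the corners of the staircase of \<open>I\<close> with the faces of these boxes.
  If \<open>v\<close> is a minimal exponent vector of \<open>I\<close> with \<open>v\<^sub>j \<ge> 1\<close>, lowering \<open>v\<^sub>j\<close> by one leaves \<open>I\<close>, so it
  leaves some component \<open>Q\<close>; as \<open>v\<close> itself is in \<open>Q\<close>, the face of the box of \<open>Q\<close> in direction \<open>j\<close>
  is at height exactly \<open>v\<^sub>j\<close>. Conversely, let \<open>x\<^sub>j\<close> to the power \<open>q\<close> be in \<open>G(Q)\<close>. As \<open>Q\<close> is not
  redundant, some point \<open>e\<close> lies in the box of \<open>Q\<close> and in no other box. Move it in direction \<open>j\<close> up to
  height \<open>q - 1\<close>: it stays in the box of \<open>Q\<close>. One step further it has left all boxes,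
  and a minimal exponent vector of \<open>I\<close> below this last point must have \<open>j\<close>-th entry \<open>q\<close>, since
  otherwise it would lie below the previous point.
\<close>

section \<open>Exponent vectors\<close>

abbreviation (input) "lookup \<equiv> Poly_Mapping.lookup"

abbreviation (input) "keys \<equiv> Poly_Mapping.keys"

definition minimal_exponents :: "('n \<Rightarrow>\<^sub>0 nat) set \<Rightarrow> ('n \<Rightarrow>\<^sub>0 nat) set"
  where "minimal_exponents U = {a \<in> U. \<forall>b\<in>U. lookup b \<le> lookup a \<longrightarrow> b = a}"

definition up_closure :: "('n \<Rightarrow>\<^sub>0 nat) set \<Rightarrow> ('n \<Rightarrow>\<^sub>0 nat) set"
  where "up_closure A = {a. \<exists>b\<in>A. lookup b \<le> lookup a}"

lemma up_closureE:
  assumes "a \<in> up_closure A"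
  obtains b where "b \<in> A" "lookup b \<le> lookup a"
  using assms by (auto simp: up_closure_def)

lemma up_closure_increasing: "A \<subseteq> up_closure A"
  by (auto simp: up_closure_def)

lemma up_closure_upward: "a \<in> up_closure A \<Longrightarrow> lookup a \<le> lookup b \<Longrightarrow> b \<in> up_closure A"
  by (auto simp: up_closure_def intro: order_trans)

text \<open>Descent terminates because the total degree drops.\<close>

lemma ex_minimal_exponent_below:
  fixes a :: "'n::finite \<Rightarrow>\<^sub>0 nat"
  assumes "a \<in> U"
  shows "\<exists>b\<in>minimal_exponents U. lookup b \<le> lookup a"
  using assms
proof (induction "\<Sum>j\<in>UNIV. lookup a j" arbitrary: a rule: less_induct)
  case less
  show ?case
  proof (cases "a \<in> minimal_exponents U")
    case False
    then obtain b where b: "b \<in> U" "lookup b \<le> lookup a" "b \<noteq> a"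
      using less.prems by (auto simp: minimal_exponents_def)
    then obtain j where "lookup b j < lookup a j"
      by (metis le_funD le_neq_implies_less poly_mapping_eqI)
    then have "(\<Sum>j\<in>UNIV. lookup b j) < (\<Sum>j\<in>UNIV. lookup a j)"
      using b(2) by (intro sum_strict_mono_ex1) (auto simp: le_fun_def)
    from less.hyps[OF this b(1)] show ?thesis
      using b(2) order_trans by blast
  qed blast
qed

lemma up_closure_minimal_exponents:
  fixes A :: "('n::finite \<Rightarrow>\<^sub>0 nat) set"
  shows "up_closure (minimal_exponents (up_closure A)) = up_closure A"
proof
  show "up_closure A \<subseteq> up_closure (minimal_exponents (up_closure A))"
    using ex_minimal_exponent_below by (fastforce simp: up_closure_def[of "minimal_exponents _"])
  show "up_closure (minimal_exponents (up_closure A)) \<subseteq> up_closure A"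
  proof
    fix a
    assume "a \<in> up_closure (minimal_exponents (up_closure A))"
    then obtain b where "b \<in> minimal_exponents (up_closure A)" "lookup b \<le> lookup a"
      by (rule up_closureE)
    then have "b \<in> up_closure A" "lookup b \<le> lookup a"
      by (simp_all add: minimal_exponents_def)
    then show "a \<in> up_closure A"
      by (rule up_closure_upward)
  qed
qed

lemma minimal_exponents_up_closure_subset: "minimal_exponents (up_closure A) \<subseteq> A"
  using up_closure_increasing[of A] by (fastforce simp: minimal_exponents_def up_closure_def)


section \<open>Monomial ideals and their exponent vectors\<close>

interpretation ideals: module "(*) :: 'a::comm_ring_1 \<Rightarrow> 'a \<Rightarrow> 'a"
  by (rule module_times)

definition exponents :: "('n, 'k::comm_ring_1) mvpoly set \<Rightarrow> ('n \<Rightarrow>\<^sub>0 nat) set"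
  where "exponents I = {a. monom a \<in> I}"

lemma keys_monom [simp]: "keys (monom a :: ('n, 'k::field) mvpoly) = {a}"
  by (simp add: monom_def)

lemma inj_monom: "inj (monom :: _ \<Rightarrow> ('n, 'k::field) mvpoly)"
  by (metis injI keys_monom singleton_inject)

lemma var_power_eq_monom: "var j ^ k = monom (Poly_Mapping.single j k)"
  by (induction k) (simp_all add: var_def monom_def mult_single single_add [symmetric])

lemma lookup_single_le_iff: "lookup (Poly_Mapping.single j k) \<le> lookup a \<longleftrightarrow> k \<le> lookup a j"
  for a :: "'n \<Rightarrow>\<^sub>0 nat"
  by (auto simp: le_fun_def lookup_single when_def)

text \<open>
  The polynomials supported on an upward closed set form an ideal, and each term of such a
  polynomial is a multiple of a generator.
\<close>

lemma mem_ideal_generated_monom_iff: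
  fixes f :: "('n, 'k::field) mvpoly"
  shows "f \<in> ideal_generated (monom ` A) \<longleftrightarrow> keys f \<subseteq> up_closure A"
proof
  let ?T = "{f :: ('n, 'k) mvpoly. keys f \<subseteq> up_closure A}"
  have "ideals.subspace ?T"
  proof (rule ideals.subspaceI)
    fix f g :: "('n, 'k) mvpoly"
    assume "f \<in> ?T" "g \<in> ?T"
    then show "f + g \<in> ?T"
      using Poly_Mapping.keys_add[of f g] by auto
  next
    fix g f :: "('n, 'k) mvpoly"
    assume f: "f \<in> ?T"
    have "c + a \<in> up_closure A" if "a \<in> keys f" for c a
      using f that by (auto intro: up_closure_upward[of a] simp: le_fun_def lookup_add)
    then show "g * f \<in> ?T"
      using keys_mult[of g f] by blast
  qed simp
  moreover have "monom ` A \<subseteq> ?T"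
    using up_closure_increasing[of A] by auto
  ultimately show "keys f \<subseteq> up_closure A" if "f \<in> ideal_generated (monom ` A)"
    using that ideals.span_minimal unfolding ideal_generated_def by blast
next
  assume f: "keys f \<subseteq> up_closure A"
  have "Poly_Mapping.single a (lookup f a) \<in> ideals.span (monom ` A)" if a: "a \<in> keys f" for a
  proof -
    obtain b where b: "b \<in> A" "lookup b \<le> lookup a"
      using f a by (blast elim: up_closureE)
    have "a = (a - b) + b"
      using b(2) by (intro poly_mapping_eqI) (simp add: lookup_add lookup_minus le_fun_def)
    then have "Poly_Mapping.single a (lookup f a)
        = Poly_Mapping.single (a - b) (lookup f a) * monom b"
      by (simp add: monom_def mult_single)
    with b(1) show ?thesis
      by (simp add: ideals.span_base ideals.span_scale)
  qed
  then have "(\<Sum>a\<in>keys f. Poly_Mapping.single a (lookup f a)) \<in> ideals.span (monom ` A)"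
    by (rule ideals.span_sum)
  moreover have "(\<Sum>a\<in>keys f. Poly_Mapping.single a (lookup f a)) = f"
    by (rule poly_mapping_eqI) (simp add: lookup_sum lookup_single when_def in_keys_iff)
  ultimately show "f \<in> ideal_generated (monom ` A)"
    by (simp add: ideal_generated_def)
qed

lemma exponents_ideal_generated_monom:
  "exponents (ideal_generated (monom ` A) :: ('n, 'k::field) mvpoly set) = up_closure A"
  by (auto simp: exponents_def mem_ideal_generated_monom_iff)

lemma ideal_generated_monom_eq_iff:
  "ideal_generated (monom ` A) = (ideal_generated (monom ` B) :: ('n, 'k::field) mvpoly set)
    \<longleftrightarrow> up_closure A = up_closure B"
proof
  assume "up_closure A = up_closure B"
  then show "ideal_generated (monom ` A) = (ideal_generated (monom ` B) :: ('n, 'k) mvpoly set)"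
    by (auto simp: mem_ideal_generated_monom_iff)
qed (metis exponents_ideal_generated_monom)

lemma monomial_idealE:
  assumes "monomial_ideal I"
  obtains A where "I = ideal_generated (monom ` A)"
  using assms by (metis monomial_ideal_def subset_imageE)

lemma mem_monomial_ideal_iff:
  fixes I :: "('n, 'k::field) mvpoly set"
  assumes "monomial_ideal I"
  shows "f \<in> I \<longleftrightarrow> keys f \<subseteq> exponents I"
proof -
  obtain A where "I = ideal_generated (monom ` A)"
    using assms by (rule monomial_idealE)
  then show ?thesis
    by (simp add: exponents_ideal_generated_monom mem_ideal_generated_monom_iff)
qed

lemma exponents_upward:
  fixes I :: "('n, 'k::field) mvpoly set"
  assumes "monomial_ideal I" "a \<in> exponents I" "lookup a \<le> lookup b"
  shows "b \<in> exponents I"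
proof -
  obtain A where "I = ideal_generated (monom ` A)"
    using assms(1) by (rule monomial_idealE)
  then show ?thesis
    using assms(2,3) up_closure_upward by (simp add: exponents_ideal_generated_monom) blast
qed

text \<open>
  Every set of exponents generating \<open>I\<close> contains the minimal elements, and these already generate.
\<close>

lemma min_gens_monomial_ideal:
  fixes I :: "('n::finite, 'k::field) mvpoly set"
  assumes "monomial_ideal I"
  shows "min_gens I = monom ` minimal_exponents (exponents I)"
proof -
  obtain A where I: "I = ideal_generated (monom ` A)"
    using assms by (rule monomial_idealE)
  let ?M = "minimal_exponents (up_closure A)"
  have gen: "ideal_generated (monom ` ?M) = I"
    by (simp add: I ideal_generated_monom_eq_iff up_closure_minimal_exponents)
  have least: "monom ` ?M \<subseteq> H" if H: "H \<subseteq> range monom" "ideal_generated H = I"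
    for H :: "('n, 'k) mvpoly set"
  proof -
    obtain B where B: "H = monom ` B"
      using H(1) by (rule subset_imageE)
    with H(2) have "up_closure B = up_closure A"
      by (simp add: I ideal_generated_monom_eq_iff)
    then show ?thesis
      using minimal_exponents_up_closure_subset[of B] B by auto
  qed
  have "min_gens I = monom ` ?M"
    unfolding min_gens_def
  proof (rule the_equality)
    show "is_min_monomial_gens I (monom ` ?M)"
      unfolding is_min_monomial_gens_def
    proof (intro conjI allI impI)
      fix H :: "('n, 'k) mvpoly set"
      assume H: "H \<subset> monom ` ?M"
      then have "H \<subseteq> range monom"
        by blast
      with H show "ideal_generated H \<noteq> I"
        using least by (metis leD)
    qed (use gen in auto)
    show "G = monom ` ?M" if "is_min_monomial_gens I G" for G
      using that gen least[of G] unfolding is_min_monomial_gens_def by (metis psubsetI)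
  qed
  then show ?thesis
    by (simp add: I exponents_ideal_generated_monom)
qed


section \<open>Irreducible monomial ideals\<close>

text \<open>
  If \<open>c = a + b\<close> with \<open>a\<close>, \<open>b\<close> nonzero and of disjoint support, then a vector above both \<open>a\<close> and \<open>b\<close>
  is above \<open>c\<close>, so adjoining the monomial of \<open>a\<close> or that of \<open>b\<close> to \<open>Q\<close> gives two larger ideals
  that intersect in \<open>Q\<close>. Here \<open>a\<close> is taken to be the part of \<open>c\<close> on a single variable.
\<close>

lemma minimal_exponent_irreducible:
  fixes Q :: "('n::finite, 'k::field) mvpoly set"
  assumes mon: "monomial_ideal Q" and irr: "irreducible_ideal Q"
    and c: "c \<in> minimal_exponents (exponents Q)"
  shows "\<exists>j. \<exists>k\<ge>1. c = Poly_Mapping.single j k"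
proof -
  define U where "U = exponents Q"
  have cU: "c \<in> U" and cmin: "\<And>b. b \<in> U \<Longrightarrow> lookup b \<le> lookup c \<Longrightarrow> b = c"
    using c by (auto simp: minimal_exponents_def U_def)
  have up: "up_closure U = U"
    using exponents_upward[OF mon] by (auto simp: up_closure_def U_def)
  have "c \<noteq> 0"
  proof
    assume "c = 0"
    with cU have "a \<in> exponents Q" for a
      using exponents_upward[OF mon, of 0 a] by (simp add: U_def le_fun_def)
    then have "Q = UNIV"
      by (auto simp: mem_monomial_ideal_iff[OF mon])
    with irr show False
      by (simp add: irreducible_ideal_def)
  qed
  then obtain j where "lookup c j \<noteq> 0"
    by (metis poly_mapping_eqI lookup_zero)
  then have j: "lookup c j \<ge> 1"
    by simp
  define a where "a = Poly_Mapping.single j (lookup c j)"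
  define b where "b = c - a"
  have lookup_b: "lookup b k = (if k = j then 0 else lookup c k)" for k
    by (simp add: b_def a_def lookup_minus lookup_single when_def)
  have "a = c"
  proof (rule ccontr)
    assume "a \<noteq> c"
    moreover have "lookup a \<le> lookup c"
      by (simp add: a_def lookup_single_le_iff)
    ultimately have aU: "a \<notin> U"
      using cmin by blast
    have "lookup b \<le> lookup c"
      by (simp add: le_fun_def lookup_b)
    moreover have "b \<noteq> c"
      using j lookup_b[of j] by auto
    ultimately have bU: "b \<notin> U"
      using cmin by blast
    define J where "J d = (ideal_generated (monom ` insert d U) :: ('n, 'k) mvpoly set)" for d
    have mem_J: "f \<in> J d \<longleftrightarrow> keys f \<subseteq> U \<union> {e. lookup d \<le> lookup e}" for f d
    proof -
      have "up_closure (insert d U) = U \<union> {e. lookup d \<le> lookup e}"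
        using up by (auto simp: up_closure_def)
      then show ?thesis
        by (simp add: J_def mem_ideal_generated_monom_iff del: image_insert)
    qed
    have mem_Q: "f \<in> Q \<longleftrightarrow> keys f \<subseteq> U" for f
      by (simp add: mem_monomial_ideal_iff[OF mon] U_def)
    have "is_ideal (J d)" for d
      by (simp add: J_def is_ideal_def ideal_generated_def)
    moreover have larger: "Q \<subset> J d" if "d \<notin> U" for d
    proof -
      have "monom d \<in> J d" "monom d \<notin> Q"
        using that by (auto simp: mem_J mem_Q)
      moreover have "Q \<subseteq> J d"
        by (auto simp: mem_J mem_Q)
      ultimately show ?thesis
        by blast
    qed
    moreover have "Q = J a \<inter> J b"
    proof -
      have "e \<in> U" if "lookup a \<le> lookup e" "lookup b \<le> lookup e" for e
      proof -
        have "lookup c k \<le> lookup e k" for k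
          using that(1) le_funD[OF that(2), of k] lookup_b[of k] unfolding a_def lookup_single_le_iff
          by (cases "k = j") simp_all
        then have "lookup c \<le> lookup e"
          by (rule le_funI)
        with cU show "e \<in> U"
          using exponents_upward[OF mon] by (simp add: U_def)
      qed
      then have "keys f \<subseteq> U \<longleftrightarrow>
          keys f \<subseteq> U \<union> {e. lookup a \<le> lookup e} \<and> keys f \<subseteq> U \<union> {e. lookup b \<le> lookup e}"
        for f :: "('n, 'k) mvpoly"
        by blast
      then show ?thesis
        by (simp add: set_eq_iff mem_J mem_Q)
    qed
    ultimately show False
      using irr larger[OF aU] larger[OF bU] unfolding irreducible_ideal_def by metis
  qed
  with j show ?thesis
    unfolding a_def by metis
qed

text \<open>
  One coordinate decides membership: the exponent vectors outside \<open>Q\<close> form a box.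
\<close>

lemma exponents_irreducible_coordinate:
  fixes Q :: "('n::finite, 'k::field) mvpoly set"
  assumes "monomial_ideal Q" "irreducible_ideal Q" "a \<in> exponents Q"
  shows "\<exists>j. Poly_Mapping.single j (lookup a j) \<in> exponents Q"
proof -
  obtain b where b: "b \<in> minimal_exponents (exponents Q)" "lookup b \<le> lookup a"
    using ex_minimal_exponent_below[OF assms(3)] by blast
  then obtain j k where jk: "b = Poly_Mapping.single j k"
    using minimal_exponent_irreducible[OF assms(1,2)] by blast
  moreover have "b \<in> exponents Q"
    using b(1) by (simp add: minimal_exponents_def)
  ultimately have "Poly_Mapping.single j (lookup a j) \<in> exponents Q"
    using b(2) by (auto intro: exponents_upward[OF assms(1)] simp: lookup_single_le_iff)
  then show ?thesis ..
qed


section \<open>Corners of the staircase and faces of the boxes\<close>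

theorem lemma1:
  fixes I :: "('n::finite, 'k::field) mvpoly set"
    and v :: "nat \<Rightarrow> ('n \<Rightarrow>\<^sub>0 nat)" and r m :: nat
    and Q :: "nat \<Rightarrow> ('n, 'k) mvpoly set"
  assumes "monomial_ideal I"
    and "min_gens I = (\<lambda>i. monom (v i)) ` {1..r}"
    and "irreducible_decomposition I m Q"
  shows "{var j ^ Poly_Mapping.lookup (v i) j | i j. i \<in> {1..r} \<and> Poly_Mapping.lookup (v i) j \<ge> 1}
    = (\<Union>i\<in>{1..m}. min_gens (Q i))"
proof -
  have mon: "monomial_ideal (Q i)" and irr: "irreducible_ideal (Q i)" if "i \<in> {1..m}" for i
    using assms(3) that by (auto simp: irreducible_decomposition_def)
  have I_eq: "I = (\<Inter>i\<in>{1..m}. Q i)"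
    and irredundant: "\<And>l. l \<in> {1..m} \<Longrightarrow> I \<noteq> (\<Inter>i\<in>{1..m} - {l}. Q i)"
    using assms(3) unfolding irreducible_decomposition_def by blast+
  have exp_I: "a \<in> exponents I \<longleftrightarrow> (\<forall>i\<in>{1..m}. a \<in> exponents (Q i))" for a
    by (simp add: I_eq exponents_def)
  have "(monom :: _ \<Rightarrow> ('n, 'k) mvpoly) ` (v ` {1..r}) = monom ` minimal_exponents (exponents I)"
    using assms(2) by (simp add: min_gens_monomial_ideal[OF assms(1)] image_image)
  then have v: "v ` {1..r} = minimal_exponents (exponents I)"
    by (simp add: inj_image_eq_iff[OF inj_monom])

  have face_of_corner: "\<exists>i\<in>{1..m}. Poly_Mapping.single j (lookup u j) \<in> minimal_exponents (exponents (Q i))"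
    if u: "u \<in> minimal_exponents (exponents I)" and j: "lookup u j \<ge> 1" for u j
  proof -
    define w where "w = u - Poly_Mapping.single j 1"
    have lookup_w: "lookup w k = (if k = j then lookup u j - 1 else lookup u k)" for k
      by (simp add: w_def lookup_minus lookup_single when_def)
    have "lookup w \<le> lookup u"
      by (simp add: le_fun_def lookup_w)
    moreover have "w \<noteq> u"
      using j lookup_w[of j] by auto
    ultimately have "w \<notin> exponents I"
      using u by (auto simp: minimal_exponents_def)
    then obtain i where i: "i \<in> {1..m}" "w \<notin> exponents (Q i)"
      by (auto simp: exp_I)
    \<comment> \<open>No vector below \<open>w\<close> is an exponent of \<open>Q i\<close>, so the deciding coordinate of \<open>u\<close> is the lowered one.\<close>
    have outside: "Poly_Mapping.single k t \<notin> exponents (Q i)" if "t \<le> lookup w k" for k t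
      using i exponents_upward[OF mon] that lookup_single_le_iff by metis
    have "u \<in> exponents (Q i)"
      using u i(1) exp_I by (auto simp: minimal_exponents_def)
    then obtain k where k: "Poly_Mapping.single k (lookup u k) \<in> exponents (Q i)"
      using exponents_irreducible_coordinate[OF mon irr] i(1) by blast
    have "k = j"
      using outside[of "lookup u k" k] k lookup_w[of k] by (auto split: if_splits)
    have "b = Poly_Mapping.single j (lookup u j)"
      if b: "b \<in> exponents (Q i)" "lookup b \<le> lookup (Poly_Mapping.single j (lookup u j))" for b
    proof -
      have b0: "lookup b k = 0" if "k \<noteq> j" for k
        using le_funD[OF b(2), of k] that by (simp add: lookup_single)
      then have b_eq: "b = Poly_Mapping.single j (lookup b j)"
        by (intro poly_mapping_eqI) (auto simp: lookup_single when_def)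
      then have "\<not> lookup b j \<le> lookup w j"
        using outside b(1) by metis
      moreover have "lookup b j \<le> lookup u j"
        using le_funD[OF b(2), of j] by simp
      ultimately have "lookup b j = lookup u j"
        using lookup_w[of j] by simp
      with b_eq show ?thesis
        by simp
    qed
    with k \<open>k = j\<close> i(1) show ?thesis
      by (auto simp: minimal_exponents_def)
  qed

  have corner_of_face: "\<exists>u\<in>minimal_exponents (exponents I). \<exists>j. lookup u j \<ge> 1 \<and>
      c = Poly_Mapping.single j (lookup u j)"
    if i: "i \<in> {1..m}" and c: "c \<in> minimal_exponents (exponents (Q i))" for i c
  proof -
    obtain j q where q: "q \<ge> 1" "c = Poly_Mapping.single j q"
      using minimal_exponent_irreducible[OF mon[OF i] irr[OF i] c] by blast
    have cQ: "c \<in> exponents (Q i)"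
      using c by (simp add: minimal_exponents_def)
    have below_q: "Poly_Mapping.single j t \<notin> exponents (Q i)" if "t < q" for t
    proof
      assume "Poly_Mapping.single j t \<in> exponents (Q i)"
      moreover have "lookup (Poly_Mapping.single j t) \<le> lookup c"
        using that by (simp add: q(2) lookup_single_le_iff)
      ultimately have "Poly_Mapping.single j t = c"
        using c by (auto simp: minimal_exponents_def)
      with that show False
        by (metis q(2) lookup_single_eq less_irrefl)
    qed
    obtain e where e: "e \<notin> exponents (Q i)" "\<And>l. l \<in> {1..m} - {i} \<Longrightarrow> e \<in> exponents (Q l)"
    proof -
      obtain f where f: "f \<in> (\<Inter>l\<in>{1..m} - {i}. Q l)" "f \<notin> I"
        using irredundant[OF i] I_eq by blast
      then have "f \<notin> Q i"
        using I_eq by auto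
      then obtain e where "e \<in> keys f" "e \<notin> exponents (Q i)"
        using mem_monomial_ideal_iff[OF mon[OF i]] by auto
      moreover have "keys f \<subseteq> exponents (Q l)" if "l \<in> {1..m} - {i}" for l
        using f(1) that mem_monomial_ideal_iff[OF mon, of l f] by blast
      ultimately show thesis
        using that by blast
    qed
    \<comment> \<open>Height \<open>q - 1\<close> is the last one inside the box of \<open>Q i\<close>; raising \<open>e\<close> cannot re-enter another box.\<close>
    define p where "p t = Poly_Mapping.update j t e" for t
    have lookup_p: "lookup (p t) k = (if k = j then t else lookup e k)" for t k
      by (simp add: p_def lookup_update)
    have "lookup e j < q"
      using e(1) exponents_upward[OF mon[OF i] cQ, of e] by (metis q(2) lookup_single_le_iff not_le)
    then have e_le: "lookup e \<le> lookup (p t)" if "t \<ge> q - 1" for t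
      using that by (auto simp: le_fun_def lookup_p)
    have "p (q - 1) \<notin> exponents (Q i)"
    proof
      assume "p (q - 1) \<in> exponents (Q i)"
      then obtain k where k: "Poly_Mapping.single k (lookup (p (q - 1)) k) \<in> exponents (Q i)"
        using exponents_irreducible_coordinate[OF mon irr] i by blast
      have "k \<noteq> j"
        using k below_q[of "q - 1"] q(1) by (auto simp: lookup_p)
      with k have "Poly_Mapping.single k (lookup e k) \<in> exponents (Q i)"
        by (simp add: lookup_p)
      then have "e \<in> exponents (Q i)"
        by (rule exponents_upward[OF mon[OF i]]) (simp add: lookup_single_le_iff)
      with e(1) show False ..
    qed
    then have before: "p (q - 1) \<notin> exponents I"
      using exp_I i by blast
    have "p q \<in> exponents (Q l)" if "l \<in> {1..m}" for l
    proof (cases "l = i")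
      case True
      then show ?thesis
        using exponents_upward[OF mon[OF i] cQ, of "p q"] by (simp add: q(2) lookup_single_le_iff lookup_p)
    next
      case False
      then show ?thesis
        using that e(2) e_le[of q] exponents_upward[OF mon, of l e "p q"] by simp
    qed
    then have "p q \<in> exponents I"
      by (simp add: exp_I)
    then obtain u where u: "u \<in> minimal_exponents (exponents I)" "lookup u \<le> lookup (p q)"
      using ex_minimal_exponent_below by blast
    have "lookup u j = q"
    proof (rule ccontr)
      assume "lookup u j \<noteq> q"
      then have "lookup u k \<le> lookup (p (q - 1)) k" for k
        using le_funD[OF u(2), of k] by (auto simp: lookup_p split: if_splits)
      then have "lookup u \<le> lookup (p (q - 1))"
        by (rule le_funI)
      then have "p (q - 1) \<in> exponents I"
        using u(1) exponents_upward[OF assms(1)] by (auto simp: minimal_exponents_def)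
      with before show False ..
    qed
    with u(1) q show ?thesis
      by blast
  qed

  have "{var j ^ lookup (v i) j | i j. i \<in> {1..r} \<and> lookup (v i) j \<ge> 1}
      = monom ` {Poly_Mapping.single j (lookup u j) | u j.
          u \<in> minimal_exponents (exponents I) \<and> lookup u j \<ge> 1}"
    unfolding v[symmetric] var_power_eq_monom by blast
  also have "{Poly_Mapping.single j (lookup u j) | u j.
          u \<in> minimal_exponents (exponents I) \<and> lookup u j \<ge> 1}
      = (\<Union>i\<in>{1..m}. minimal_exponents (exponents (Q i)))"
  proof (intro subset_antisym subsetI)
    fix c
    assume "c \<in> (\<Union>i\<in>{1..m}. minimal_exponents (exponents (Q i)))"
    then show "c \<in> {Poly_Mapping.single j (lookup u j) | u j.
        u \<in> minimal_exponents (exponents I) \<and> lookup u j \<ge> 1}"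
      using corner_of_face by blast
  qed (use face_of_corner in blast)
  also have "monom ` \<dots> = (\<Union>i\<in>{1..m}. min_gens (Q i))"
    by (simp add: image_UN min_gens_monomial_ideal[OF mon])
  finally show ?thesis .
qed

end
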